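(* Let $(\mathcal N,\mathcal O,\mathfrak l)$ be a plabic network with perfect orientation $\mathcal O$, positive edge weights $w_e$ and gauge ray direction $\mathfrak l$, and let $E_e$ be its edge vectors. Then the edge vectors satisfy the following linear equations at each internal vertex. (1) At each bivalent vertex with incoming edge $e$ and outgoing edge $f$: $$E_e=(-1)^{\mathrm{int}(e)+\mathrm{wind}(e,f)}\,w_e\,E_f .$$ (2) At each trivalent black vertex with incoming edges $e_2,e_3$ and outgoing edge $e_1$: $$E_{e_2}=(-1)^{\mathrm{int}(e_2)+\mathrm{wind}(e_2,e_1)}\,w_{e_2}E_{e_1},\qquad E_{e_3}=(-1)^{\mathrm{int}(e_3)+\mathrm{wind}(e_3,e_1)}\,w_{e_3}E_{e_1}.$$ (3) At each trivalent white vertex with incoming edge $e_3$ and outgoing edges $e_1,e_2$: $$E_{e_3}=(-1)^{\mathrm{int}(e_3)+\mathrm{wind}(e_3,e_1)}\,w_{e_3}E_{e_1}+(-1)^{\mathrm{int}(e_3)+\mathrm{wind}(e_3,e_2)}\,w_{e_3}E_{e_2}.$$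
   Context: **Plabic networks.** Let $D$ be a closed convex disk whose boundary contains a straight segment. A plabic graph $\mathcal G$ is a finite directed planar graph embedded in $D$ with straight edges. It has boundary vertices $b_1,\dots,b_n$ on the segment, labelled clockwise, each of degree 1 (a source if its edge is outgoing, a sink otherwise). The remaining (internal) vertices lie inside $D$ and have degree 2 or 3. No component is isolated from the boundary. The graph is perfect: each internal vertex has exactly one incoming edge (then it is white) or exactly one outgoing edge (then it is black); a bivalent vertex has one incoming and one outgoing edge and is given either color. The orientation $\mathcal O$ is called a perfect orientation. $I=\{i_1<\dots<i_k\}$ is the set of indices of the boundary sources and $\bar I=[n]\setminus I$. A network $\mathcal N$ is $\mathcal G$ with a positive weight $w_e$ on each edge. **Gauge rays.** A gauge ray direction $\mathfrak l$ is an oriented direction, not parallel to any edge, such that the rays with direction $\mathfrak l$ starting at boundary vertices point inside $D$ and contain no internal vertices. The gauge rays are the rays $\mathfrak l_{i_r}$ starting at the boundary sources $b_{i_r}$. $\mathrm{int}(e)$ is the number of intersections of the edge $e$ with the gauge rays (the base point of a ray is not counted). **Winding.** For nonzero planar vectors, $s(a,b)=+1,0,-1$ if the ordered pair $(a,b)$ is positively oriented, parallel, negatively oriented respectively. For consecutive directed edges $e,f$: $\mathrm{wind}(e,f)=1$ if $s(e,f)=s(e,\mathfrak l)=s(\mathfrak l,f)=1$; $\mathrm{wind}(e,f)=-1$ if $s(e,f)=s(e,\mathfrak l)=s(\mathfrak l,f)=-1$; otherwise $0$. **Edge vectors.** For a directed path $\mathcal P=(e_1,\dots,e_m)$ (edges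 may repeat) put $w(\mathcal P)=\prod_l w_{e_l}$, $\mathrm{wind}(\mathcal P)=\sum_{l=1}^{m-1}\mathrm{wind}(e_l,e_{l+1})$, $\mathrm{int}(\mathcal P)=\sum_l \mathrm{int}(e_l)$. The edge vector $E_e\in\mathbb R^n$ has components $$(E_e)_j=\sum_{\mathcal P:e\to b_j}(-1)^{\mathrm{wind}(\mathcal P)+\mathrm{int}(\mathcal P)}w(\mathcal P),$$ the sum being over all directed paths with first edge $e$ ending at $b_j$ (zero if there are none). If the sum is infinite it is understood as a formal power series in the weights (convergent for sufficiently small weights). At the edge $e$ ending at a boundary sink $b_j$, $(E_e)_l=(-1)^{\mathrm{int}(e)}w_e\delta_{jl}$. *)

theory Defs
  imports
    "HOL-Analysis.Analysis"
    "HOL-Library.Multiset"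
    "Graph_Theory.Digraph"
    "Graph_Theory.Arc_Walk"
    "Graph_Theory.Digraph_Component"
begin

text \<open>
  The plane is \<^typ>\<open>complex\<close>. The vertices of a graph are points of the plane, and an arc \<open>e\<close> is
  drawn as the straight segment from its tail to its head.
\<close>

datatype vertex_colour = White | Black

definition edge_dir :: "(complex, 'e) pre_digraph \<Rightarrow> 'e \<Rightarrow> complex" where
  "edge_dir G e = head G e - tail G e"

definition edge_segment :: "(complex, 'e) pre_digraph \<Rightarrow> 'e \<Rightarrow> complex set" where
  "edge_segment G e = closed_segment (tail G e) (head G e)"

text \<open>
  The function \<open>s(a,b)\<close>: for \<open>a = a1 + i a2\<close> and \<open>b = b1 + i b2\<close> one has
  \<open>Im (cnj a * b) = a1 b2 - a2 b1\<close>.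
\<close>

definition orientation_sign :: "complex \<Rightarrow> complex \<Rightarrow> int" where
  "orientation_sign a b =
     (if Im (cnj a * b) > 0 then 1 else if Im (cnj a * b) < 0 then - 1 else 0)"


section \<open>Plabic networks and gauge ray directions\<close>

definition internal_verts :: "(complex, 'e) pre_digraph \<Rightarrow> nat \<Rightarrow> (nat \<Rightarrow> complex) \<Rightarrow> complex set" where
  "internal_verts G n b = verts G - b ` {1..n}"

text \<open>
  The points \<open>p\<close>, \<open>q\<close> are the ends of the straight segment in the boundary of the disk \<open>D\<close>, and
  \<open>b 1, \<dots>, b n\<close> are the boundary vertices. Moving clockwise along the boundary keeps the disk on
  the right hand side; this is what \<open>clockwise\<close> expresses, and it makes the \<open>b j\<close> distinct and
  linearly ordered along the segment. The absence of loops and parallel arcs contained in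
  \<^locale>\<open>digraph\<close> is automatic for edges that are straight segments. By \<open>embedded\<close>, and since no
  vertex has degree 0, no vertex lies in the interior of an edge.
\<close>

locale plabic_graph = digraph G
  for G :: "(complex, 'e) pre_digraph" +
  fixes D :: "complex set" and p q :: complex
    and n :: nat and b :: "nat \<Rightarrow> complex" and col :: "complex \<Rightarrow> vertex_colour"
  assumes disk: "compact D" "convex D" "interior D \<noteq> {}"
    and segment: "p \<noteq> q" "closed_segment p q \<subseteq> frontier D"
    and boundary_verts: "b ` {1..n} \<subseteq> verts G \<inter> closed_segment p q"
    and clockwise: "\<And>i j z. \<lbrakk>1 \<le> i; i < j; j \<le> n; z \<in> interior D\<rbrakk>
          \<Longrightarrow> orientation_sign (b j - b i) (z - b i) = - 1"
    and boundary_degree: "\<And>j. j \<in> {1..n} \<Longrightarrow> in_degree G (b j) + out_degree G (b j) = 1"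
    and internal_inside: "internal_verts G n b \<subseteq> interior D"
    and internal_degree: "\<And>v. v \<in> internal_verts G n b
          \<Longrightarrow> in_degree G v + out_degree G v \<in> {2, 3}"
    and white: "\<And>v. \<lbrakk>v \<in> internal_verts G n b; col v = White\<rbrakk> \<Longrightarrow> in_degree G v = 1"
    and black: "\<And>v. \<lbrakk>v \<in> internal_verts G n b; col v = Black\<rbrakk> \<Longrightarrow> out_degree G v = 1"
    and embedded: "\<And>e f. \<lbrakk>e \<in> arcs G; f \<in> arcs G; e \<noteq> f\<rbrakk>
          \<Longrightarrow> edge_segment G e \<inter> edge_segment G f
              \<subseteq> {tail G e, head G e} \<inter> {tail G f, head G f}"
    and no_isolated_component: "\<And>v. v \<in> verts G
          \<Longrightarrow> \<exists>j\<in>{1..n}. v \<rightarrow>\<^sup>*\<^bsub>with_proj (mk_symmetric G)\<^esub> b j"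

locale plabic_network = plabic_graph G D p q n b col
  for G :: "(complex, 'e) pre_digraph" and D p q n b col +
  fixes w :: "'e \<Rightarrow> real"
  assumes weight_pos: "\<And>e. e \<in> arcs G \<Longrightarrow> w e > 0"

definition boundary_sources :: "(complex, 'e) pre_digraph \<Rightarrow> nat \<Rightarrow> (nat \<Rightarrow> complex) \<Rightarrow> nat set" where
  "boundary_sources G n b = {i \<in> {1..n}. out_degree G (b i) = 1}"

text \<open>Rays are taken without their base point.\<close>

definition open_ray :: "complex \<Rightarrow> complex \<Rightarrow> complex set" where
  "open_ray x l = {x + t *\<^sub>R l | t. t > 0}"

definition gauge_direction ::
    "(complex, 'e) pre_digraph \<Rightarrow> complex set \<Rightarrow> nat \<Rightarrow> (nat \<Rightarrow> complex) \<Rightarrow> complex \<Rightarrow> bool" where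
  "gauge_direction G D n b l \<longleftrightarrow>
     l \<noteq> 0 \<and>
     (\<forall>e\<in>arcs G. orientation_sign (edge_dir G e) l \<noteq> 0) \<and>
     (\<forall>j\<in>{1..n}. open_ray (b j) l \<inter> interior D \<noteq> {}) \<and>
     (\<forall>j\<in>{1..n}. open_ray (b j) l \<inter> internal_verts G n b = {})"

text \<open>
  If \<open>l\<close> is a gauge ray direction then every summand is 0 or 1, as no edge is parallel to \<open>l\<close>.
\<close>

definition edge_int ::
    "(complex, 'e) pre_digraph \<Rightarrow> nat \<Rightarrow> (nat \<Rightarrow> complex) \<Rightarrow> complex \<Rightarrow> 'e \<Rightarrow> nat" where
  "edge_int G n b l e =
     (\<Sum>i\<in>boundary_sources G n b. card (edge_segment G e \<inter> open_ray (b i) l))"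

definition wind :: "(complex, 'e) pre_digraph \<Rightarrow> complex \<Rightarrow> 'e \<Rightarrow> 'e \<Rightarrow> int" where
  "wind G l e f =
     (if orientation_sign (edge_dir G e) (edge_dir G f) = 1
         \<and> orientation_sign (edge_dir G e) l = 1
         \<and> orientation_sign l (edge_dir G f) = 1 then 1
      else if orientation_sign (edge_dir G e) (edge_dir G f) = - 1
         \<and> orientation_sign (edge_dir G e) l = - 1
         \<and> orientation_sign l (edge_dir G f) = - 1 then - 1
      else 0)"


section \<open>Edge vectors\<close>

definition edge_paths :: "(complex, 'e) pre_digraph \<Rightarrow> 'e \<Rightarrow> complex \<Rightarrow> 'e list set" where
  "edge_paths G e v = {P. P \<noteq> [] \<and> hd P = e \<and> pre_digraph.awalk G (tail G e) P v}"

definition path_weight :: "('e \<Rightarrow> real) \<Rightarrow> 'e list \<Rightarrow> real" where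
  "path_weight w P = (\<Prod>e\<leftarrow>P. w e)"

definition path_wind :: "(complex, 'e) pre_digraph \<Rightarrow> complex \<Rightarrow> 'e list \<Rightarrow> int" where
  "path_wind G l P = (\<Sum>i<length P - 1. wind G l (P ! i) (P ! Suc i))"

definition path_int ::
    "(complex, 'e) pre_digraph \<Rightarrow> nat \<Rightarrow> (nat \<Rightarrow> complex) \<Rightarrow> complex \<Rightarrow> 'e list \<Rightarrow> nat" where
  "path_int G n b l P = (\<Sum>e\<leftarrow>P. edge_int G n b l e)"

definition path_sign ::
    "(complex, 'e) pre_digraph \<Rightarrow> nat \<Rightarrow> (nat \<Rightarrow> complex) \<Rightarrow> complex \<Rightarrow> 'e list \<Rightarrow> real" where
  "path_sign G n b l P = (- 1) powi (path_wind G l P + int (path_int G n b l P))"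

text \<open>
  The edge vector with numerical weights. Components are indexed by \<open>j \<in> {1..n}\<close>. The sum may be
  infinite, in which case it has its intended meaning only if \<open>edge_vector_converges\<close>. For small
  weights this is always so, see \<open>edge_vector_converges_for_small_weights\<close> below; it is also so
  for arbitrary weights if there are only finitely many paths.
\<close>

definition edge_vector ::
    "(complex, 'e) pre_digraph \<Rightarrow> nat \<Rightarrow> (nat \<Rightarrow> complex) \<Rightarrow> complex \<Rightarrow> ('e \<Rightarrow> real)
      \<Rightarrow> 'e \<Rightarrow> nat \<Rightarrow> real" where
  "edge_vector G n b l w e j =
     (\<Sum>\<^sub>\<infinity>P\<in>edge_paths G e (b j). path_sign G n b l P * path_weight w P)"

definition edge_vector_converges ::
    "(complex, 'e) pre_digraph \<Rightarrow> nat \<Rightarrow> (nat \<Rightarrow> complex) \<Rightarrow> complex \<Rightarrow> ('e \<Rightarrow> real) \<Rightarrow> 'e \<Rightarrow> bool" where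
  "edge_vector_converges G n b l w e \<longleftrightarrow>
     (\<forall>j\<in>{1..n}. (\<lambda>P. path_sign G n b l P * path_weight w P) summable_on edge_paths G e (b j))"

text \<open>
  Formal power series in the edge weights: a monomial is a finite multiset of edges, and a series
  is its family of coefficients.
\<close>

type_synonym 'e weight_series = "'e multiset \<Rightarrow> real"

definition series_mult :: "'e weight_series \<Rightarrow> 'e weight_series \<Rightarrow> 'e weight_series" where
  "series_mult F H M = (\<Sum>A | A \<subseteq># M. F A * H (M - A))"

definition weight_var :: "'e \<Rightarrow> 'e weight_series" where
  "weight_var e M = (if M = {#e#} then 1 else 0)"

text \<open>
  The edge vector as a vector of formal power series. The weight of a path \<open>P\<close> is the monomial
  \<open>mset P\<close>, so every coefficient is a finite sum.
\<close>

definition formal_edge_vector ::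
    "(complex, 'e) pre_digraph \<Rightarrow> nat \<Rightarrow> (nat \<Rightarrow> complex) \<Rightarrow> complex
      \<Rightarrow> 'e \<Rightarrow> nat \<Rightarrow> 'e weight_series" where
  "formal_edge_vector G n b l e j M =
     (\<Sum>P | P \<in> edge_paths G e (b j) \<and> mset P = M. path_sign G n b l P)"

lemma finite_paths_of_monomial: "finite {P. P \<in> edge_paths G e v \<and> mset P = M}"
proof (rule finite_subset)
  show "{P. P \<in> edge_paths G e v \<and> mset P = M}
      \<subseteq> {P. set P \<subseteq> set_mset M \<and> length P = size M}"
    by auto
  show "finite {P. set P \<subseteq> set_mset M \<and> length P = size M}"
    by (rule finite_lists_length_eq) simp
qed

lemma sum_path_weight_length:
  assumes "finite A"
  shows "(\<Sum>P | set P \<subseteq> A \<and> length P = m. path_weight w P) = (\<Sum>e\<in>A. w e) ^ m"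
proof (induction m)
  case 0
  have "{P. set P \<subseteq> A \<and> length P = 0} = {[]}" by auto
  then show ?case by (simp add: path_weight_def)
next
  case (Suc m)
  let ?L = "\<lambda>m. {P. set P \<subseteq> A \<and> length P = m}"
  have eq: "?L (Suc m) = (\<lambda>(e, P). e # P) ` (A \<times> ?L m)"
    by (auto simp: length_Suc_conv image_iff)
  have inj: "inj_on (\<lambda>(e, P). e # P) (A \<times> ?L m)"
    by (auto simp: inj_on_def)
  have "(\<Sum>P\<in>?L (Suc m). path_weight w P) = (\<Sum>(e, P)\<in>A \<times> ?L m. w e * path_weight w P)"
    unfolding eq by (subst sum.reindex[OF inj]) (simp add: case_prod_beta path_weight_def)
  also have "\<dots> = (\<Sum>e\<in>A. w e) * (\<Sum>P\<in>?L m. path_weight w P)"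
    by (simp add: sum_product sum.cartesian_product)
  finally show ?case using Suc.IH by simp
qed

lemma edge_vector_converges_for_small_weights:
  fixes G :: "(complex, 'e) pre_digraph"
  assumes "fin_digraph G"
  shows "\<exists>\<epsilon>>0. \<forall>w. (\<forall>e\<in>arcs G. 0 < w e \<and> w e < \<epsilon>)
           \<longrightarrow> (\<forall>e\<in>arcs G. edge_vector_converges G n b l w e)"
proof -
  interpret fin_digraph G by fact
  define A where "A = arcs G"
  define \<epsilon> :: real where "\<epsilon> = 1 / (2 * (real (card A) + 1))"
  have fA: "finite A" by (simp add: A_def)
  have "edge_vector_converges G n b l w e"
    if w: "\<forall>e\<in>arcs G. 0 < w e \<and> w e < \<epsilon>" for w e
    unfolding edge_vector_converges_def
  proof
    fix j
    define \<sigma> where "\<sigma> = (\<Sum>e\<in>A. w e)"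
    have \<sigma>0: "0 \<le> \<sigma>" unfolding \<sigma>_def using w by (intro sum_nonneg) (auto simp: A_def less_imp_le)
    have "\<sigma> \<le> (\<Sum>e\<in>A. \<epsilon>)"
      unfolding \<sigma>_def using w by (intro sum_mono) (auto simp: A_def less_imp_le)
    also have "\<dots> \<le> 1 / 2" by (simp add: \<epsilon>_def field_simps)
    finally have \<sigma>2: "\<sigma> \<le> 1 / 2" .
    have nonneg: "0 \<le> path_weight w P" if "set P \<subseteq> A" for P
      using that w by (induction P) (auto simp: path_weight_def A_def less_imp_le)
    have sub: "edge_paths G e (b j) \<subseteq> lists A"
      by (auto simp: edge_paths_def awalk_def A_def)
    have "(\<lambda>P. path_weight w P) summable_on lists A"
    proof (rule nonneg_bdd_above_summable_on)
      show "bdd_above (sum (path_weight w) ` {F. F \<subseteq> lists A \<and> finite F})"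
      proof (rule bdd_aboveI2)
        fix F assume F: "F \<in> {F. F \<subseteq> lists A \<and> finite F}"
        define K where "K = Suc (Max (length ` F))"
        let ?L = "\<lambda>m. {P. set P \<subseteq> A \<and> length P = m}"
        have sub: "F \<subseteq> (\<Union>m<K. ?L m)"
          using F by (auto simp: K_def less_Suc_eq_le lists_eq_set)
        have fin: "finite (?L m)" for m using fA by (rule finite_lists_length_eq)
        have "sum (path_weight w) F \<le> sum (path_weight w) (\<Union>m<K. ?L m)"
          using sub fin nonneg by (intro sum_mono2) auto
        also have "\<dots> = (\<Sum>m<K. sum (path_weight w) (?L m))"
          using fin by (intro sum.UNION_disjoint) auto
        also have "\<dots> = (\<Sum>m<K. \<sigma> ^ m)"
          using sum_path_weight_length[OF fA] by (simp add: \<sigma>_def)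
        also have "\<dots> \<le> (\<Sum>m. \<sigma> ^ m)"
          using \<sigma>0 \<sigma>2 by (intro sum_le_suminf summable_geometric) auto
        finally show "sum (path_weight w) F \<le> (\<Sum>m. \<sigma> ^ m)" .
      qed
    qed (use nonneg in \<open>auto simp: lists_eq_set\<close>)
    then have s: "(\<lambda>P. path_weight w P) summable_on edge_paths G e (b j)"
      using sub summable_on_subset_banach by blast
    have "(\<lambda>P. norm (path_sign G n b l P * path_weight w P)) summable_on edge_paths G e (b j)"
    proof (rule summable_on_cong[THEN iffD1, OF _ s])
      fix P assume "P \<in> edge_paths G e (b j)"
      then have "0 \<le> path_weight w P" using sub by (intro nonneg) (auto simp: lists_eq_set)
      moreover have "\<bar>path_sign G n b l P\<bar> = 1"
        by (simp add: path_sign_def power_int_abs)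
      ultimately show "path_weight w P = norm (path_sign G n b l P * path_weight w P)"
        by (simp add: abs_mult)
    qed
    then show "(\<lambda>P. path_sign G n b l P * path_weight w P) summable_on edge_paths G e (b j)"
      by (rule Infinite_Sum.abs_summable_summable)
  qed
  moreover have "\<epsilon> > 0" by (simp add: \<epsilon>_def)
  ultimately show ?thesis by blast
qed

end

theory Submission
  imports Defs
begin

text \<open>
  A path from \<open>e\<close> to \<open>b j\<close> cannot stop at the internal head \<open>v\<close> of \<open>e\<close>, so it is \<open>e\<close> followed by a
  path to \<open>b j\<close> whose first edge \<open>f\<close> leaves \<open>v\<close>. Prepending \<open>e\<close> multiplies the signed weight of the
  path by \<open>(-1)^(int(e) + wind(e,f)) w_e\<close>, a factor that depends only on \<open>e\<close> and \<open>f\<close>; summing over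
  all paths gives one equation valid at every internal vertex, of which the three cases are instances.
\<close>

text \<open>The exponent is written exactly as in the theorem, so that the sign can be folded in the
  goal at the end.\<close>

definition step_sign ::
    "(complex, 'e) pre_digraph \<Rightarrow> nat \<Rightarrow> (nat \<Rightarrow> complex) \<Rightarrow> complex \<Rightarrow> 'e \<Rightarrow> 'e \<Rightarrow> real" where
  "step_sign G n b l e f = (- 1) powi (int (edge_int G n b l e) + wind G l e f)"

text \<open>Winding sums over consecutive pairs, so prepending \<open>e\<close> creates the single
  new pair \<open>(e, hd P)\<close>, which exists because \<open>P\<close> is nonempty.\<close>

lemma path_sign_Cons:
  assumes "P \<noteq> []"
  shows "path_sign G n b l (e # P) = step_sign G n b l e (hd P) * path_sign G n b l P"
proof -
  obtain f Q where P: "P = f # Q" using assms by (cases P) auto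
  \<comment> \<open>The new pair sits at index 0, so the sum is split at its lower end and the rest
    shifted; the default rule would split off the last term.\<close>
  have "path_wind G l (e # P) = wind G l e f + path_wind G l P"
    by (simp add: P path_wind_def sum.lessThan_Suc_shift del: sum.lessThan_Suc)
  then show ?thesis
    by (simp add: P path_sign_def step_sign_def path_int_def power_int_add algebra_simps)
qed

text \<open>In the convolution only \<open>A = {#e#}\<close> contributes, so multiplying by the
  variable of \<open>e\<close> shifts coefficients by one copy of \<open>e\<close>.\<close>

lemma series_mult_weight_var:
  "series_mult (weight_var e) F M = (if e \<in># M then F (M - {#e#}) else 0)"
proof -
  \<comment> \<open>Finiteness, required for \<open>sum.delta\<close>: each submultiset comes from a
    list of bounded length over a finite set.\<close>
  have "{A. A \<subseteq># M} \<subseteq> mset ` {xs. set xs \<subseteq> set_mset M \<and> length xs \<le> size M}"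
  proof
    fix A assume A: "A \<in> {A. A \<subseteq># M}"
    obtain xs where "A = mset xs" by (metis ex_mset)
    with A show "A \<in> mset ` {xs. set xs \<subseteq> set_mset M \<and> length xs \<le> size M}"
      using set_mset_mono[of A M] size_mset_mono[of A M] by auto
  qed
  then have fin: "finite {A. A \<subseteq># M}"
    by (rule finite_subset) (simp add: finite_lists_length_le)
  have "series_mult (weight_var e) F M
      = (\<Sum>A | A \<subseteq># M. if A = {#e#} then F (M - {#e#}) else 0)"
    unfolding series_mult_def weight_var_def by (rule sum.cong) auto
  also have "\<dots> = (if e \<in># M then F (M - {#e#}) else 0)"
    using fin by (simp add: sum.delta)
  finally show ?thesis .
qed

context
  fixes G :: "(complex, 'e) pre_digraph"
  assumes wf: "wf_digraph G"
begin

interpretation wf_digraph G by (fact wf)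

lemma edge_paths_Cons:
  assumes e: "e \<in> arcs G" and v: "head G e \<noteq> x"
  shows "edge_paths G e x = (\<lambda>(f, P). e # P) ` (SIGMA f:out_arcs G (head G e). edge_paths G f x)"
proof (intro equalityI subsetI)
  fix R assume "R \<in> edge_paths G e x"
  then obtain P where R: "R = e # P" and P: "awalk (head G e) P x"
    by (cases R) (auto simp: edge_paths_def awalk_Cons_iff)
  \<comment> \<open>An empty \<open>P\<close> would force \<open>head G e = x\<close>.\<close>
  from v P obtain f Q where fQ: "P = f # Q" by (cases P) (auto simp: awalk_Nil_iff)
  have "f \<in> out_arcs G (head G e)" "P \<in> edge_paths G f x"
    using P by (auto simp: fQ edge_paths_def awalk_Cons_iff)
  then show "R \<in> (\<lambda>(f, P). e # P) ` (SIGMA f:out_arcs G (head G e). edge_paths G f x)"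
    using R by force
next
  fix R assume "R \<in> (\<lambda>(f, P). e # P) ` (SIGMA f:out_arcs G (head G e). edge_paths G f x)"
  then show "R \<in> edge_paths G e x"
    using e by (auto simp: edge_paths_def awalk_Cons_iff)
qed

text \<open>The map drops the index \<open>f\<close>, but \<open>f\<close> is recovered as
  \<open>hd P\<close>.\<close>

lemma inj_on_Cons_edge_paths:
  "inj_on (\<lambda>(f, P). e # P) (SIGMA f:A. edge_paths G f x)"
  by (auto simp: inj_on_def edge_paths_def)

lemma formal_edge_vector_step:
  assumes e: "e \<in> arcs G" and v: "head G e \<noteq> b j" and fin: "finite (out_arcs G (head G e))"
  shows "formal_edge_vector G n b l e j M
    = (\<Sum>f\<in>out_arcs G (head G e).
        step_sign G n b l e f * series_mult (weight_var e) (formal_edge_vector G n b l f j) M)"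
proof -
  let ?O = "out_arcs G (head G e)" and ?s = "path_sign G n b l"
  let ?S = "\<lambda>f. {P. P \<in> edge_paths G f (b j) \<and> add_mset e (mset P) = M}"
  have S: "{P. P \<in> edge_paths G e (b j) \<and> mset P = M} = (\<lambda>(f, P). e # P) ` (SIGMA f:?O. ?S f)"
    unfolding edge_paths_Cons[OF e v] by force
  have inj: "inj_on (\<lambda>(f, P). e # P) (SIGMA f:?O. ?S f)"
    by (rule inj_on_subset[OF inj_on_Cons_edge_paths]) auto
  \<comment> \<open>\<open>M\<close> must contain \<open>e\<close>, and then one copy is removed:
    the same case split as in \<open>series_mult_weight_var\<close>.\<close>
  have S_eq: "?S f = (if e \<in># M then {P. P \<in> edge_paths G f (b j) \<and> mset P = M - {#e#}} else {})" for f
    by auto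
  have finS: "finite (?S f)" for f
    unfolding S_eq by (simp add: finite_paths_of_monomial)
  have "formal_edge_vector G n b l e j M = (\<Sum>(f, P)\<in>(SIGMA f:?O. ?S f). ?s (e # P))"
    unfolding formal_edge_vector_def S
    by (subst sum.reindex[OF inj]) (simp add: case_prod_unfold o_def)
  also have "\<dots> = (\<Sum>f\<in>?O. \<Sum>P\<in>?S f. ?s (e # P))"
    using fin finS by (subst sum.Sigma) auto
  also have "\<dots> = (\<Sum>f\<in>?O. \<Sum>P\<in>?S f. step_sign G n b l e f * ?s P)"
    by (intro sum.cong refl) (auto simp: edge_paths_def path_sign_Cons)
  also have "\<dots> = (\<Sum>f\<in>?O. step_sign G n b l e f
      * series_mult (weight_var e) (formal_edge_vector G n b l f j) M)"
    by (cases "e \<in># M")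
       (simp_all add: S_eq series_mult_weight_var formal_edge_vector_def sum_distrib_left)
  finally show ?thesis .
qed

text \<open>Convergence at \<open>e\<close> carries over, by reindexing, to the disjoint union of
  the path sets of the next edges; this justifies grouping the infinite sum by
  \<open>f\<close>.\<close>

lemma edge_vector_step:
  assumes e: "e \<in> arcs G" and v: "head G e \<noteq> b j" and fin: "finite (out_arcs G (head G e))"
    and j: "j \<in> {1..n}" and conv: "edge_vector_converges G n b l w e"
  shows "edge_vector G n b l w e j
    = (\<Sum>f\<in>out_arcs G (head G e). step_sign G n b l e f * w e * edge_vector G n b l w f j)"
proof -
  let ?O = "out_arcs G (head G e)"
  let ?t = "\<lambda>P. path_sign G n b l P * path_weight w P"
  let ?S = "SIGMA f:?O. edge_paths G f (b j)"
  have "?t summable_on edge_paths G e (b j)"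
    using conv j by (simp add: edge_vector_converges_def)
  then have sum: "(\<lambda>(f, P). ?t (e # P)) summable_on ?S"
    unfolding edge_paths_Cons[OF e v] summable_on_reindex[OF inj_on_Cons_edge_paths]
    by (simp add: o_def case_prod_unfold)
  have "edge_vector G n b l w e j = (\<Sum>\<^sub>\<infinity>(f, P)\<in>?S. ?t (e # P))"
    unfolding edge_vector_def edge_paths_Cons[OF e v]
    by (subst infsum_reindex[OF inj_on_Cons_edge_paths]) (simp add: o_def case_prod_unfold)
  \<comment> \<open>The outer infinite sum runs over the finite set \<open>?O\<close>, hence is an
    ordinary sum.\<close>
  also have "\<dots> = (\<Sum>f\<in>?O. \<Sum>\<^sub>\<infinity>P\<in>edge_paths G f (b j). ?t (e # P))"
    using infsum_Sigma'_banach[OF sum] fin by simp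
  also have "\<dots> = (\<Sum>f\<in>?O. \<Sum>\<^sub>\<infinity>P\<in>edge_paths G f (b j). step_sign G n b l e f * w e * ?t P)"
    by (intro sum.cong infsum_cong refl)
       (auto simp: edge_paths_def path_sign_Cons path_weight_def)
  \<comment> \<open>Over the reals a constant always leaves \<open>infsum\<close>: a nonzero factor
    preserves summability and non-summability, and a non-summable family has sum 0.\<close>
  also have "\<dots> = (\<Sum>f\<in>?O. step_sign G n b l e f * w e * edge_vector G n b l w f j)"
    by (simp add: edge_vector_def infsum_cmult_right')
  finally show ?thesis .
qed

end

theorem lemma3p10:
  fixes G :: "(complex, 'e) pre_digraph" and D :: "complex set" and p q :: complex
    and n :: nat and b :: "nat \<Rightarrow> complex" and col :: "complex \<Rightarrow> vertex_colour"
    and w :: "'e \<Rightarrow> real" and l :: complex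
  assumes "plabic_network G D p q n b col w"
    and "gauge_direction G D n b l"
  shows
    "(\<forall>v\<in>internal_verts G n b. \<forall>e f.
       in_degree G v + out_degree G v = 2 \<and> in_arcs G v = {e} \<and> out_arcs G v = {f} \<longrightarrow>
         (\<forall>j\<in>{1..n}. \<forall>M. formal_edge_vector G n b l e j M
            = (- 1) powi (int (edge_int G n b l e) + wind G l e f)
                * series_mult (weight_var e) (formal_edge_vector G n b l f j) M) \<and>
         (edge_vector_converges G n b l w e \<longrightarrow>
           (\<forall>j\<in>{1..n}. edge_vector G n b l w e j
              = (- 1) powi (int (edge_int G n b l e) + wind G l e f)
                  * w e * edge_vector G n b l w f j))) \<and>
     (\<forall>v\<in>internal_verts G n b. \<forall>e1 e2 e3.
       in_degree G v + out_degree G v = 3 \<and> col v = Black \<and>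
       e2 \<noteq> e3 \<and> in_arcs G v = {e2, e3} \<and> out_arcs G v = {e1} \<longrightarrow>
         (\<forall>e\<in>{e2, e3}.
           (\<forall>j\<in>{1..n}. \<forall>M. formal_edge_vector G n b l e j M
              = (- 1) powi (int (edge_int G n b l e) + wind G l e e1)
                  * series_mult (weight_var e) (formal_edge_vector G n b l e1 j) M) \<and>
           (edge_vector_converges G n b l w e \<longrightarrow>
             (\<forall>j\<in>{1..n}. edge_vector G n b l w e j
                = (- 1) powi (int (edge_int G n b l e) + wind G l e e1)
                    * w e * edge_vector G n b l w e1 j)))) \<and>
     (\<forall>v\<in>internal_verts G n b. \<forall>e1 e2 e3.
       in_degree G v + out_degree G v = 3 \<and> col v = White \<and>
       e1 \<noteq> e2 \<and> in_arcs G v = {e3} \<and> out_arcs G v = {e1, e2} \<longrightarrow>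
         (\<forall>j\<in>{1..n}. \<forall>M. formal_edge_vector G n b l e3 j M
            = (- 1) powi (int (edge_int G n b l e3) + wind G l e3 e1)
                * series_mult (weight_var e3) (formal_edge_vector G n b l e1 j) M
            + (- 1) powi (int (edge_int G n b l e3) + wind G l e3 e2)
                * series_mult (weight_var e3) (formal_edge_vector G n b l e2 j) M) \<and>
         (edge_vector_converges G n b l w e3 \<longrightarrow>
           (\<forall>j\<in>{1..n}. edge_vector G n b l w e3 j
              = (- 1) powi (int (edge_int G n b l e3) + wind G l e3 e1)
                  * w e3 * edge_vector G n b l w e1 j
              + (- 1) powi (int (edge_int G n b l e3) + wind G l e3 e2)
                  * w e3 * edge_vector G n b l w e2 j)))"
proof -
  interpret plabic_network G D p q n b col w by fact
  have internal: "e \<in> arcs G" "head G e = v" "v \<noteq> b j" "finite (out_arcs G v)"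
    if "v \<in> internal_verts G n b" "e \<in> in_arcs G v" "j \<in> {1..n}" for v e j
    using that finite_out_arcs by (auto simp: internal_verts_def)
  have formal: "formal_edge_vector G n b l e j M
      = (\<Sum>f\<in>out_arcs G v.
          step_sign G n b l e f * series_mult (weight_var e) (formal_edge_vector G n b l f j) M)"
    if "v \<in> internal_verts G n b" "e \<in> in_arcs G v" "j \<in> {1..n}" for v e j M
    using internal[OF that] formal_edge_vector_step[OF wf_digraph_axioms, of e b j n l M] by simp
  have numeric: "edge_vector G n b l w e j
      = (\<Sum>f\<in>out_arcs G v. step_sign G n b l e f * w e * edge_vector G n b l w f j)"
    if "v \<in> internal_verts G n b" "e \<in> in_arcs G v" "j \<in> {1..n}" "edge_vector_converges G n b l w e"
    for v e j
    using internal[OF that(1-3)] that(3,4) edge_vector_step[OF wf_digraph_axioms, of e b j n l w] by simp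
  show ?thesis
    \<comment> \<open>Each case gives \<open>out_arcs G v\<close> as an explicit set, so the sum
      over it expands to one or two terms; \<open>e1 \<noteq> e2\<close> keeps the two terms at a
      white vertex separate.\<close>
    by (intro conjI ballI allI impI; elim conjE)
       (simp_all add: formal numeric flip: step_sign_def)
qed

end
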